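(* Let $N\ge 1$ be an integer and $0<p<1$. Consider a particle on the integers $\{0,1,\dots,N\}$ which, when at a position $x$ with $0<x<N$, moves to $x-1$ with probability $\frac{1-p}{2}$, to $x+1$ with probability $\frac{1-p}{2}$, or to $N-x$ with probability $p$, and which stops upon reaching $0$ or $N$. Let $f(x)$ denote the probability that the particle starting at $x$ eventually reaches $N$ (so $f(0)=0$, $f(N)=1$ and $f(x)=\frac{1-p}{2}f(x-1)+\frac{1-p}{2}f(x+1)+pf(N-x)$ for $0<x<N$). Then for $0\le x\le N$, \[ f(x)=\frac{1}{2}\,\frac{\left(\frac{1-\sqrt{p}}{1+\sqrt{p}}\right)^N+1}{\left(\frac{1+\sqrt{p}}{1-\sqrt{p}}\right)^N-\left(\frac{1-\sqrt{p}}{1+\sqrt{p}}\right)^N}\left(\frac{1+\sqrt{p}}{1-\sqrt{p}}\right)^x +\frac{1}{2}\,\frac{\left(\frac{1+\sqrt{p}}{1-\sqrt{p}}\right)^N+1}{\left(\frac{1-\sqrt{p}}{1+\sqrt{p}}\right)^N-\left(\frac{1+\sqrt{p}}{1-\sqrt{p}}\right)^N}\left(\frac{1-\sqrt{p}}{1+\sqrt{p}}\right)^x+\frac{1}{2}. \]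
   Context: The move from $x$ to $N-x$ is called the mirror step; the case where the left and right step probabilities are both $\frac{1-p}{2}$ is the symmetric case considered here. *)

theory Defs
  imports "HOL-Probability.Probability"
begin

text \<open>The process \<open>X\<close> on the probability space \<open>M\<close> is a time-homogeneous Markov chain with
  transition probabilities \<open>T\<close> (\<open>T y z\<close> is the probability of moving from \<open>y\<close> to \<open>z\<close>) started
  at \<open>x\<close>. As \<open>cond_prob\<close> is a quotient with \<open>a / 0 = 0\<close>, only histories of nonzero probability
  are constrained.\<close>

definition markov_chain ::
    "'a measure \<Rightarrow> ('s::countable \<Rightarrow> 's \<Rightarrow> real) \<Rightarrow> 's \<Rightarrow> (nat \<Rightarrow> 'a \<Rightarrow> 's) \<Rightarrow> bool" where
  "markov_chain M T x X \<longleftrightarrow>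
     prob_space M \<and>
     (\<forall>n. X n \<in> measurable M (count_space UNIV)) \<and>
     (AE \<omega> in M. X 0 \<omega> = x) \<and>
     (\<forall>n h z. \<P>(\<omega> in M. \<forall>i\<le>n. X i \<omega> = h i) \<noteq> 0 \<longrightarrow>
        \<P>(\<omega> in M. X (Suc n) \<omega> = z \<bar> \<forall>i\<le>n. X i \<omega> = h i) = T (h n) z)"

text \<open>The three moves are added up because their targets may coincide (e.g. \<open>N - y = y + 1\<close> if
  \<open>N = 2 * y + 1\<close>). Stopping at \<open>0\<close> and \<open>N\<close> is expressed by making these states absorbing.\<close>

definition mirror_transition :: "real \<Rightarrow> nat \<Rightarrow> nat \<Rightarrow> nat \<Rightarrow> real" where
  "mirror_transition p N y z =
     (if 0 < y \<and> y < N
      then (1 - p) / 2 * of_bool (z = y - 1) + (1 - p) / 2 * of_bool (z = y + 1)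
           + p * of_bool (z = N - y)
      else of_bool (z = y))"

text \<open>Not used in the statement: such Markov chains exist for all parameters. One is obtained by
  driving the walk with an i.i.d. sequence of moves.\<close>

datatype move = Step_Left | Step_Right | Mirror_Step

instance move :: countable by countable_datatype

fun apply_move :: "nat \<Rightarrow> move \<Rightarrow> nat \<Rightarrow> nat" where
  "apply_move N Step_Left y = y - 1"
| "apply_move N Step_Right y = y + 1"
| "apply_move N Mirror_Step y = N - y"

definition apply_or_stop :: "nat \<Rightarrow> move \<Rightarrow> nat \<Rightarrow> nat" where
  "apply_or_stop N m y = (if 0 < y \<and> y < N then apply_move N m y else y)"

definition move_pmf :: "real \<Rightarrow> move pmf" where
  "move_pmf p = bind_pmf (bernoulli_pmf p) (\<lambda>b. if b then return_pmf Mirror_Step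
           else map_pmf (\<lambda>c. if c then Step_Left else Step_Right) (bernoulli_pmf (1/2)))"

fun walk_pos :: "nat \<Rightarrow> nat \<Rightarrow> nat \<Rightarrow> move stream \<Rightarrow> nat" where
  "walk_pos N 0 x w = x"
| "walk_pos N (Suc n) x w = walk_pos N n (apply_or_stop N (shd w) x) (stl w)"

lemma UNIV_move: "(UNIV :: move set) = {Step_Left, Step_Right, Mirror_Step}"
  using move.exhaust by auto

lemma nn_integral_move_pmf:
  assumes "0 < p" "p < 1" and c: "(c::real)\<ge>0"
  shows "(\<integral>\<^sup>+m. ennreal (of_bool (apply_or_stop N m y = z) * c) \<partial>move_pmf p) = ennreal (mirror_transition p N y z * c)"
proof -
  have d: "pmf (move_pmf p) Mirror_Step = p" "pmf (move_pmf p) Step_Left = (1-p)/2" "pmf (move_pmf p) Step_Right = (1-p)/2"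
    using assms by (auto simp: move_pmf_def pmf_bind map_pmf_def)
  have "(\<integral>\<^sup>+m. ennreal (of_bool (apply_or_stop N m y = z) * c) \<partial>move_pmf p) = ennreal (\<integral>m. of_bool (apply_or_stop N m y = z) * c \<partial>move_pmf p)"
    using c by (intro nn_integral_eq_integral) (auto intro!: integrable_measure_pmf_finite simp: finite_subset[OF subset_UNIV] UNIV_move)
  also have "(\<integral>m. of_bool (apply_or_stop N m y = z) * c \<partial>move_pmf p) = (\<Sum>m\<in>{Step_Left,Step_Right,Mirror_Step}. of_bool (apply_or_stop N m y = z) * c * pmf (move_pmf p) m)"
    by (rule integral_measure_pmf_real) (simp, metis UNIV_I UNIV_move)
  also have "\<dots> = mirror_transition p N y z * c"
    by (auto simp: d apply_or_stop_def mirror_transition_def field_simps)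
  finally show ?thesis .
qed

abbreviation "move_space p \<equiv> stream_space (measure_pmf (move_pmf p))"

lemma measurable_pos[measurable]: "walk_pos N n x \<in> measurable (move_space p) (count_space UNIV)"
proof (induction n arbitrary: x)
  case 0 show ?case by simp
next
  case (Suc n)
  note Suc[measurable]
  have "(\<lambda>w. (\<lambda>m w. walk_pos N n (apply_or_stop N m x) (stl w)) (shd w) w) \<in> measurable (move_space p) (count_space UNIV)"
    by (rule measurable_compose_countable'[where I=UNIV]) (auto intro: measurable_compose[OF measurable_stl Suc] measurable_compose[OF measurable_shd])
  then show ?case by simp
qed

lemma prob_space_move_space: "prob_space (move_space p)"
  by (rule prob_space.prob_space_stream_space) (rule prob_space_measure_pmf)

lemma mirror_transition_nonneg: "0 < p \<Longrightarrow> p < 1 \<Longrightarrow> mirror_transition p N y z \<ge> 0"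
  by (auto simp: mirror_transition_def)

lemma prob_walk_path:
  assumes "0 < p" "p < 1"
  shows "\<P>(w in move_space p. \<forall>i\<le>n. walk_pos N i x w = h i) = of_bool (h 0 = x) * (\<Prod>i<n. mirror_transition p N (h i) (h (Suc i)))"
proof (induction n arbitrary: x h)
  case 0
  interpret prob_space "move_space p" by (rule prob_space_move_space)
  have "{w \<in> space (move_space p). \<forall>i\<le>0. walk_pos N i x w = h i} = (if h 0 = x then space (move_space p) else {})"
    by auto
  then show ?case using prob_space by simp
next
  case (Suc n)
  interpret prob_space "move_space p" by (rule prob_space_move_space)
  let ?c = "\<Prod>i<n. mirror_transition p N (h (Suc i)) (h (Suc (Suc i)))"
  have c0: "?c \<ge> 0" by (intro prod_nonneg ballI mirror_transition_nonneg assms)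
  have eq: "(\<forall>i\<le>Suc n. walk_pos N i x (m ## w) = h i) \<longleftrightarrow> h 0 = x \<and> (\<forall>i\<le>n. walk_pos N i (apply_or_stop N m x) w = h (Suc i))" for m w
    by (auto simp: All_less_Suc2 simp flip: less_Suc_eq_le)
  have "ennreal (\<P>(w in move_space p. \<forall>i\<le>Suc n. walk_pos N i x w = h i)) = (\<integral>\<^sup>+m. \<P>(w in move_space p. (\<forall>i\<le>Suc n. walk_pos N i x (m##w) = h i)) \<partial>move_pmf p)"
    by (rule prob_space.prob_stream_space) (auto intro: prob_space_measure_pmf)
  also have "\<dots> = (\<integral>\<^sup>+m. of_bool (h 0 = x) * ennreal (of_bool (apply_or_stop N m x = h 1) * ?c) \<partial>move_pmf p)"
    unfolding eq by (intro nn_integral_cong) (auto simp: Suc)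
  also have "\<dots> = of_bool (h 0 = x) * ennreal (mirror_transition p N x (h 1) * ?c)"
    by (simp add: nn_integral_cmult nn_integral_move_pmf[OF assms c0])
  also have "\<dots> = ennreal (of_bool (h 0 = x) * (\<Prod>i<Suc n. mirror_transition p N (h i) (h (Suc i))))"
    by (auto simp: prod.lessThan_Suc_shift simp del: prod.lessThan_Suc)
  finally show ?case
    by (subst (asm) ennreal_inj) (auto intro!: mult_nonneg_nonneg prod_nonneg mirror_transition_nonneg assms)
qed

lemma mirror_walk_exists:
  assumes "0 < p" "p < 1"
  shows "markov_chain (move_space p) (mirror_transition p N) x (\<lambda>n. walk_pos N n x)"
proof -
  have e: "(walk_pos N (Suc n) x w = z \<and> (\<forall>i\<le>n. walk_pos N i x w = h i)) \<longleftrightarrow> (\<forall>i\<le>Suc n. walk_pos N i x w = (h(Suc n := z)) i)" for n h z w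
    by (auto simp: le_Suc_eq)
  show ?thesis unfolding markov_chain_def cond_prob_def e prob_walk_path[OF assms]
    using prob_space_move_space by auto
qed

end

theory Submission
  imports Defs
begin

text \<open>With \<open>r = (1 + \<surd>p) / (1 - \<surd>p)\<close>, the claimed value equals
  \<open>g x = (1 + (r^x - r^(N-x)) / (r^N - 1)) / 2\<close>. Because \<open>r + 1/r = 2 (1 + p) / (1 - p)\<close> and
  \<open>g (N - x) = 1 - g x\<close>, the function \<open>g\<close> is harmonic for the walk, with boundary values \<open>0\<close> and \<open>1\<close>,
  so the expectation of \<open>g (X n)\<close> does not depend on \<open>n\<close>. The function \<open>y (N - y)\<close>, invariant under
  the mirror step, loses \<open>1 - p\<close> in expectation at every step from an interior point; hence the
  expected time spent in the interior is finite and the probability of being there tends to \<open>0\<close>.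
  In the limit only the absorbing states contribute to the expectation of \<open>g (X n)\<close>, which leaves
  the probability of absorption in \<open>N\<close>.\<close>

section \<open>Markov chains on countable state spaces\<close>

text \<open>\<open>markov_chain\<close> conditions on full histories. The event
  \<open>X n \<omega> = y\<close> splits into the histories ending in \<open>y\<close>, all with the
  same transition probability \<open>T y z\<close>, and summing over them forgets the past.\<close>

lemma markov_chain_step_prob:
  fixes T :: "'s::countable \<Rightarrow> 's \<Rightarrow> real"
  assumes mc: "markov_chain M T x X" and nonneg: "\<And>y z. T y z \<ge> 0"
  shows "\<P>(\<omega> in M. X n \<omega> = y \<and> X (Suc n) \<omega> = z) = \<P>(\<omega> in M. X n \<omega> = y) * T y z"
proof -
  interpret prob_space M using mc by (simp add: markov_chain_def)
  have [measurable]: "X k \<in> measurable M (count_space UNIV)" for k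
    using mc by (simp add: markov_chain_def)
  \<comment> \<open>Histories are lists of length \<open>n + 1\<close> because, unlike functions
    \<open>h\<close>, there are only countably many of them.\<close>
  let ?H = "\<lambda>l \<omega>. \<forall>i\<le>n. X i \<omega> = l ! i"
  let ?L = "{l. length l = Suc n \<and> l ! n = y}"
  have disj: "disjoint_family_on (\<lambda>l. {\<omega> \<in> space M. ?H l \<omega> \<and> P \<omega>}) ?L" for P
    unfolding disjoint_family_on_def by (auto simp: less_Suc_eq_le intro!: nth_equalityI)
  have hist: "\<exists>l\<in>?L. ?H l \<omega>" if "X n \<omega> = y" for \<omega>
    using that by (intro bexI[of _ "map (\<lambda>i. X i \<omega>) [0..<Suc n]"]) (auto simp del: upt_Suc)
  have split: "emeasure M {\<omega> \<in> space M. X n \<omega> = y \<and> P \<omega>}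
      = (\<integral>\<^sup>+l. emeasure M {\<omega> \<in> space M. ?H l \<omega> \<and> P \<omega>} \<partial>count_space ?L)"
    if [measurable]: "Measurable.pred M P" for P
  proof -
    have "{\<omega> \<in> space M. X n \<omega> = y \<and> P \<omega>} = (\<Union>l\<in>?L. {\<omega> \<in> space M. ?H l \<omega> \<and> P \<omega>})"
      using hist by auto
    then show ?thesis
      by (simp add: emeasure_UN_countable[OF _ _ disj])
  qed
  have step: "emeasure M {\<omega> \<in> space M. ?H l \<omega> \<and> X (Suc n) \<omega> = z}
      = emeasure M {\<omega> \<in> space M. ?H l \<omega>} * ennreal (T y z)" if "l \<in> ?L" for l
  proof (cases "\<P>(\<omega> in M. ?H l \<omega>) = 0")
    case True
    \<comment> \<open>The chain condition is silent on a null history, but then both sides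
      vanish.\<close>
    have "\<P>(\<omega> in M. ?H l \<omega> \<and> X (Suc n) \<omega> = z) \<le> \<P>(\<omega> in M. ?H l \<omega>)"
      by (intro finite_measure_mono) auto
    with True show ?thesis by (simp add: emeasure_eq_measure measure_le_0_iff)
  next
    case False
    with mc have "\<P>(\<omega> in M. X (Suc n) \<omega> = z \<bar> ?H l \<omega>) = T (l ! n) z"
      unfolding markov_chain_def by blast
    then have "\<P>(\<omega> in M. ?H l \<omega> \<and> X (Suc n) \<omega> = z) = \<P>(\<omega> in M. ?H l \<omega>) * T y z"
      using that False by (simp add: cond_prob_def field_simps conj_commute)
    then show ?thesis
      using nonneg by (simp add: emeasure_eq_measure ennreal_mult)
  qed
  have "emeasure M {\<omega> \<in> space M. X n \<omega> = y \<and> X (Suc n) \<omega> = z}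
      = (\<integral>\<^sup>+l. emeasure M {\<omega> \<in> space M. ?H l \<omega>} * ennreal (T y z) \<partial>count_space ?L)"
    by (subst split) (auto intro!: nn_integral_cong step)
  also have "\<dots> = emeasure M {\<omega> \<in> space M. X n \<omega> = y} * ennreal (T y z)"
    using split[of "\<lambda>_. True"] by (simp add: nn_integral_multc)
  finally show ?thesis
    using nonneg by (simp add: emeasure_eq_measure flip: ennreal_mult)
qed

text \<open>A countable union over \<open>n\<close>, \<open>y\<close>, \<open>z\<close> of null
  events is null. Facts about almost every path then follow by induction along possible
  transitions.\<close>

lemma markov_chain_AE_transition:
  fixes T :: "'s::countable \<Rightarrow> 's \<Rightarrow> real"
  assumes mc: "markov_chain M T x X" and nonneg: "\<And>y z. T y z \<ge> 0"
  shows "AE \<omega> in M. \<forall>n. T (X n \<omega>) (X (Suc n) \<omega>) \<noteq> 0"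
proof -
  interpret prob_space M using mc by (simp add: markov_chain_def)
  have [measurable]: "X k \<in> measurable M (count_space UNIV)" for k
    using mc by (simp add: markov_chain_def)
  have "AE \<omega> in M. T y z = 0 \<longrightarrow> \<not> (X n \<omega> = y \<and> X (Suc n) \<omega> = z)" for n y z
  proof (cases "T y z = 0")
    case True
    then have "\<P>(\<omega> in M. X n \<omega> = y \<and> X (Suc n) \<omega> = z) = 0"
      by (simp add: markov_chain_step_prob[OF assms])
    then show ?thesis
      by (subst (asm) prob_Collect_eq_0) auto
  qed simp
  then have "AE \<omega> in M. \<forall>n y z. T y z = 0 \<longrightarrow> \<not> (X n \<omega> = y \<and> X (Suc n) \<omega> = z)"
    unfolding AE_all_countable by blast
  then show ?thesis by eventually_elim auto
qed

text \<open>One step of the evolution of expectations, written with finite sums in place of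
  integrals.\<close>

lemma markov_chain_sum_step:
  fixes T :: "'s::countable \<Rightarrow> 's \<Rightarrow> real" and \<phi> :: "'s \<Rightarrow> real"
  assumes mc: "markov_chain M T x X" and nonneg: "\<And>y z. T y z \<ge> 0"
    and S: "finite S" "AE \<omega> in M. X n \<omega> \<in> S"
  shows "(\<Sum>z\<in>S. \<P>(\<omega> in M. X (Suc n) \<omega> = z) * \<phi> z)
      = (\<Sum>y\<in>S. \<P>(\<omega> in M. X n \<omega> = y) * (\<Sum>z\<in>S. T y z * \<phi> z))"
proof -
  interpret prob_space M using mc by (simp add: markov_chain_def)
  have [measurable]: "X k \<in> measurable M (count_space UNIV)" for k
    using mc by (simp add: markov_chain_def)
  have step: "\<P>(\<omega> in M. X (Suc n) \<omega> = z) = (\<Sum>y\<in>S. \<P>(\<omega> in M. X n \<omega> = y) * T y z)" for z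
  proof -
    have "\<P>(\<omega> in M. X (Suc n) \<omega> = z)
        = measure M (\<Union>y\<in>S. {\<omega> \<in> space M. X n \<omega> = y \<and> X (Suc n) \<omega> = z})"
      using S by (intro measure_eq_AE) auto
    also have "\<dots> = (\<Sum>y\<in>S. \<P>(\<omega> in M. X n \<omega> = y \<and> X (Suc n) \<omega> = z))"
      using S by (intro finite_measure_finite_Union) (auto simp: disjoint_family_on_def)
    finally show ?thesis by (simp add: markov_chain_step_prob[OF mc nonneg])
  qed
  show ?thesis
    unfolding step sum_distrib_left sum_distrib_right
    by (subst sum.swap) (simp add: mult.assoc)
qed

section \<open>The mirror walk\<close>

lemma mirror_transition_sum:
  fixes \<phi> :: "nat \<Rightarrow> real"
  assumes "y \<le> N"
  shows "(\<Sum>z\<le>N. mirror_transition p N y z * \<phi> z)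
      = (if 0 < y \<and> y < N
         then (1 - p) / 2 * \<phi> (y - 1) + (1 - p) / 2 * \<phi> (y + 1) + p * \<phi> (N - y) else \<phi> y)"
proof -
  \<comment> \<open>Each move is summed separately, so coinciding targets require no case
    distinction.\<close>
  have pick: "(\<Sum>z\<le>N. c * of_bool (z = a) * \<phi> z) = c * \<phi> a" if "a \<le> N" for a c
  proof -
    have "(\<Sum>z\<le>N. c * of_bool (z = a) * \<phi> z) = (\<Sum>z\<le>N. if z = a then c * \<phi> z else 0)"
      by (intro sum.cong) auto
    also have "\<dots> = c * \<phi> a" using that by (subst sum.delta) auto
    finally show ?thesis .
  qed
  show ?thesis
  proof (cases "0 < y \<and> y < N")
    case True
    then have "y - 1 \<le> N" "y + 1 \<le> N" "N - y \<le> N" by auto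
    then show ?thesis
      by (simp only: True mirror_transition_def if_True simp_thms distrib_right sum.distrib pick)
  next
    case False
    then show ?thesis
      using pick[OF assms, of 1] by (simp only: mirror_transition_def if_False mult_1)
  qed
qed

section \<open>The harmonic function of the walk\<close>

definition mirror_win :: "real \<Rightarrow> nat \<Rightarrow> nat \<Rightarrow> real" where
  "mirror_win r N x = (1 + (r ^ x - r ^ (N - x)) / (r ^ N - 1)) / 2"

text \<open>The mirror step flips the sign of \<open>g - 1/2\<close>, so this part must satisfy
  \<open>(1 - p) / 2 * (h (y - 1) + h (y + 1)) = (1 + p) * h y\<close>. The hypothesis on
  \<open>r\<close> is the characteristic equation of this recurrence.\<close>

lemma mirror_win_harmonic:
  assumes r: "(1 - p) * (r\<^sup>2 + 1) = 2 * (1 + p) * r" and y: "0 < y" "y < N"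
  shows "(1 - p) / 2 * mirror_win r N (y - 1) + (1 - p) / 2 * mirror_win r N (y + 1)
      + p * mirror_win r N (N - y) = mirror_win r N y"
proof -
  \<comment> \<open>With \<open>y = a + 1\<close> and \<open>N = a + b + 2\<close> all exponents
    become \<open>a\<close> or \<open>b\<close> plus 0, 1 or 2, free of truncated
    subtraction.\<close>
  obtain a where a: "y = Suc a" using y by (cases y) auto
  obtain b where b: "N = Suc (Suc (a + b))" using y a less_iff_Suc_add by auto
  have e: "N - (y - 1) = Suc (Suc b)" "N - y = Suc b" "N - (y + 1) = b" "N - Suc b = y"
    using a b by auto
  define d where "d = inverse (r ^ N - 1)"
  have 1: "(1 - p) * (r ^ Suc (Suc c) + r ^ c) = 2 * (1 + p) * r ^ Suc c" for c
  proof -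
    have "(1 - p) * (r ^ Suc (Suc c) + r ^ c) = (1 - p) * (r\<^sup>2 + 1) * r ^ c"
      by (simp add: algebra_simps power2_eq_square)
    then show ?thesis unfolding r by simp
  qed
  have "(1 - p) * ((r ^ a - r ^ Suc (Suc b)) + (r ^ Suc (Suc a) - r ^ b))
      + 2 * p * (r ^ Suc b - r ^ Suc a) = 2 * (r ^ Suc a - r ^ Suc b)"
    using 1[of a] 1[of b] by (simp only: ring_distribs)
  from arg_cong[OF this, of "\<lambda>t. t * d"] show ?thesis
    unfolding mirror_win_def e divide_inverse[of _ "r ^ N - 1"] d_def[symmetric]
    by (simp add: a algebra_simps add_divide_distrib diff_divide_distrib)
qed

text \<open>For \<open>R = r ^ N\<close>, the factorization
  \<open>R - 1/R = (R - 1) * (1/R + 1)\<close> reduces both coefficients to the denominator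
  \<open>R - 1\<close>.\<close>

lemma mirror_win_closed_form:
  fixes r :: real
  assumes "r > 1" "N \<ge> 1" "x \<le> N"
  shows "mirror_win r N x =
      1 / 2 * ((inverse r ^ N + 1) / (r ^ N - inverse r ^ N)) * r ^ x
    + 1 / 2 * ((r ^ N + 1) / (inverse r ^ N - r ^ N)) * inverse r ^ x + 1 / 2"
proof -
  define R where "R = r ^ N"
  have R: "R > 1" using assms by (simp add: R_def one_less_power)
  have 1: "(inverse R + 1) / (R - inverse R) = 1 / (R - 1)"
  proof -
    have "R - inverse R = (R - 1) * (inverse R + 1)" using R by (simp add: field_simps)
    moreover have "inverse R + 1 > 0" using R by (intro add_pos_pos) auto
    ultimately show ?thesis by simp
  qed
  have 2: "(R + 1) / (inverse R - R) = - R / (R - 1)"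
  proof -
    have "inverse R - R = - (R - 1) * (R + 1) / R" using R by (simp add: field_simps)
    then have "(R + 1) / (inverse R - R) = R / - (R - 1)" using R by simp
    then show ?thesis by (simp only: divide_minus_left divide_minus_right)
  qed
  have "R * inverse r ^ x = r ^ (N - x)"
    using assms by (simp add: R_def power_diff power_inverse divide_inverse)
  then have 3: "1 / 2 * (- R / (R - 1)) * inverse r ^ x = - (r ^ (N - x) / (R - 1)) / 2"
    by (simp add: field_simps)
  show ?thesis
    unfolding mirror_win_def power_inverse[of r N] R_def[symmetric] 1 2 3
    by (simp add: diff_divide_distrib add_divide_distrib)
qed

lemma mirror_win_boundary:
  assumes "(r::real) > 1" "N \<ge> 1"
  shows "mirror_win r N 0 = 0" "mirror_win r N N = 1"
proof -
  have "r ^ N > 1" using assms by (intro one_less_power) auto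
  then show "mirror_win r N 0 = 0" "mirror_win r N N = 1"
    by (auto simp: mirror_win_def divide_eq_eq add_eq_0_iff)
qed

section \<open>Path properties and limiting probabilities of the mirror walk\<close>

context
  fixes N x :: nat and p :: real and M :: "'a measure" and X :: "nat \<Rightarrow> 'a \<Rightarrow> nat"
  assumes N: "N \<ge> 1" and p: "0 < p" "p < 1" and x: "x \<le> N"
    and mc: "markov_chain M (mirror_transition p N) x X"
begin

interpretation prob_space M using mc by (simp add: markov_chain_def)

lemma mirror_walk_measurable [measurable]: "X n \<in> measurable M (count_space UNIV)"
  using mc by (simp add: markov_chain_def)

lemma mirror_walk_AE_transition:
  "AE \<omega> in M. \<forall>n. mirror_transition p N (X n \<omega>) (X (Suc n) \<omega>) \<noteq> 0"
  by (rule markov_chain_AE_transition[OF mc mirror_transition_nonneg[OF p]])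

text \<open>Every possible move maps \<open>{..N}\<close> into itself. This justifies computing
  expectations as sums over \<open>{..N}\<close>.\<close>

lemma mirror_walk_AE_le: "AE \<omega> in M. \<forall>n. X n \<omega> \<le> N"
proof -
  have "AE \<omega> in M. X 0 \<omega> = x" using mc by (simp add: markov_chain_def)
  with mirror_walk_AE_transition show ?thesis
  proof eventually_elim
    case (elim \<omega>)
    have "X n \<omega> \<le> N" for n
    proof (induction n)
      case (Suc n)
      with elim(1)[rule_format, of n] show ?case
        by (auto simp: mirror_transition_def split: if_splits) (auto simp: of_bool_def split: if_splits)
    qed (use elim x in auto)
    then show ?case by blast
  qed
qed

lemma mirror_walk_AE_absorbed: "AE \<omega> in M. \<forall>k n. X k \<omega> = N \<longrightarrow> k \<le> n \<longrightarrow> X n \<omega> = N"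
  using mirror_walk_AE_transition
proof eventually_elim
  case (elim \<omega>)
  have "X n \<omega> = N" if "k \<le> n" "X k \<omega> = N" for k n
    using that
  proof (induction n rule: dec_induct)
    case (step n)
    with elim[rule_format, of n] show ?case by (auto simp: mirror_transition_def)
  qed
  then show ?case by blast
qed

lemma mirror_walk_sum_0:
  "(\<Sum>y\<le>N. \<P>(\<omega> in M. X 0 \<omega> = y) * \<phi> y) = (\<phi> x :: real)"
proof -
  have ae: "AE \<omega> in M. X 0 \<omega> = x" using mc by (simp add: markov_chain_def)
  have "\<P>(\<omega> in M. X 0 \<omega> = y) = of_bool (y = x)" for y
  proof (cases "y = x")
    case True
    then show ?thesis using ae by (simp add: prob_Collect_eq_1)
  next
    case False
    then have "AE \<omega> in M. X 0 \<omega> \<noteq> y" using ae by auto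
    then show ?thesis using False by (simp add: prob_Collect_eq_0)
  qed
  then show ?thesis using x by (simp add: of_bool_def if_distrib[of "\<lambda>t. t * _"] cong: if_cong)
qed

lemma mirror_walk_sum_Suc:
  fixes \<phi> :: "nat \<Rightarrow> real"
  shows "(\<Sum>z\<le>N. \<P>(\<omega> in M. X (Suc n) \<omega> = z) * \<phi> z)
      = (\<Sum>y\<le>N. \<P>(\<omega> in M. X n \<omega> = y) * (if 0 < y \<and> y < N
         then (1 - p) / 2 * \<phi> (y - 1) + (1 - p) / 2 * \<phi> (y + 1) + p * \<phi> (N - y) else \<phi> y))"
proof -
  have "AE \<omega> in M. X n \<omega> \<in> {..N}" using mirror_walk_AE_le by eventually_elim auto
  from markov_chain_sum_step[OF mc mirror_transition_nonneg[OF p] _ this]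
  show ?thesis by (simp add: mirror_transition_sum)
qed

lemma mirror_walk_interior_tendsto_0:
  assumes y: "0 < y" "y < N"
  shows "(\<lambda>n. \<P>(\<omega> in M. X n \<omega> = y)) \<longlonglongrightarrow> 0"
proof -
  define w where "w y = real y * (real N - real y)" for y
  define V where "V n = (\<Sum>y\<le>N. \<P>(\<omega> in M. X n \<omega> = y) * w y)" for n
  have decr: "V (Suc n) \<le> V n - (1 - p) * \<P>(\<omega> in M. X n \<omega> = y)" for n
  proof -
    \<comment> \<open>The mean of \<open>w\<close> over the two neighbours of \<open>i\<close> is
      \<open>w i - 1\<close>, while \<open>w (N - i) = w i\<close>.\<close>
    have "(1 - p) / 2 * w (i - 1) + (1 - p) / 2 * w (i + 1) + p * w (N - i) = w i - (1 - p)"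
      if "0 < i" "i < N" for i
      using that by (simp add: w_def of_nat_diff field_simps)
    then have drift: "(if 0 < i \<and> i < N then (1 - p) / 2 * w (i - 1) + (1 - p) / 2 * w (i + 1) + p * w (N - i)
        else w i) = w i - (1 - p) * of_bool (0 < i \<and> i < N)" for i
      by simp
    have "V (Suc n) = (\<Sum>i\<le>N. \<P>(\<omega> in M. X n \<omega> = i) * (w i - (1 - p) * of_bool (0 < i \<and> i < N)))"
      unfolding V_def mirror_walk_sum_Suc by (simp only: drift)
    \<comment> \<open>Only the loss incurred at \<open>y\<close> is kept.\<close>
    also have "\<dots> \<le> (\<Sum>i\<le>N. \<P>(\<omega> in M. X n \<omega> = i) * (w i - (1 - p) * of_bool (i = y)))"
      using y p by (intro sum_mono mult_left_mono) auto
    also have "\<dots> = V n - (1 - p) * \<P>(\<omega> in M. X n \<omega> = y)"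
    proof -
      have "(\<Sum>i\<le>N. \<P>(\<omega> in M. X n \<omega> = i) * ((1 - p) * of_bool (i = y)))
          = (\<Sum>i\<le>N. if i = y then (1 - p) * \<P>(\<omega> in M. X n \<omega> = i) else 0)"
        by (intro sum.cong) auto
      also have "\<dots> = (1 - p) * \<P>(\<omega> in M. X n \<omega> = y)"
        using y by simp
      finally show ?thesis
        unfolding V_def right_diff_distrib sum_subtractf by simp
    qed
    finally show ?thesis .
  qed
  \<comment> \<open>Telescoping \<open>decr\<close> bounds the expected number of visits to
    \<open>y\<close> by \<open>V 0 / (1 - p)\<close>, as \<open>V\<close> is nonnegative.\<close>
  have "(\<Sum>k<n. (1 - p) * \<P>(\<omega> in M. X k \<omega> = y)) \<le> V 0 - V n" for n
  proof (induction n)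
    case (Suc n)
    then show ?case using decr[of n] by simp
  qed simp
  moreover have "V n \<ge> 0" for n
    unfolding V_def w_def by (intro sum_nonneg mult_nonneg_nonneg) auto
  ultimately have "(\<Sum>k<n. (1 - p) * \<P>(\<omega> in M. X k \<omega> = y)) \<le> V 0" for n
    by (smt (verit))
  then have "summable (\<lambda>k. (1 - p) * \<P>(\<omega> in M. X k \<omega> = y))"
    using p by (intro summableI_nonneg_bounded[of _ "V 0"]) auto
  then have "(\<lambda>k. (1 - p) * \<P>(\<omega> in M. X k \<omega> = y)) \<longlonglongrightarrow> 0"
    by (rule summable_LIMSEQ_zero)
  then show ?thesis
    using p by (simp add: tendsto_mult_left_iff[where l = 0, simplified])
qed

text \<open>Continuity from below along the events that \<open>N\<close> is hit by time
  \<open>n\<close>; since \<open>N\<close> is absorbing, such an event agrees almost surely with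
  \<open>X n \<omega> = N\<close>.\<close>

lemma mirror_walk_tendsto_hit: "(\<lambda>n. \<P>(\<omega> in M. X n \<omega> = N)) \<longlonglongrightarrow> \<P>(\<omega> in M. \<exists>n. X n \<omega> = N)"
proof -
  let ?A = "\<lambda>n. {\<omega> \<in> space M. \<exists>k\<le>n. X k \<omega> = N}"
  have "(\<lambda>n. measure M (?A n)) \<longlonglongrightarrow> measure M (\<Union>n. ?A n)"
    by (intro finite_Lim_measure_incseq) (auto simp: incseq_def intro: order_trans)
  moreover have "measure M (?A n) = \<P>(\<omega> in M. X n \<omega> = N)" for n
    using mirror_walk_AE_absorbed by (intro measure_eq_AE) auto
  moreover have "(\<Union>n. ?A n) = {\<omega> \<in> space M. \<exists>n. X n \<omega> = N}" by auto
  ultimately show ?thesis by simp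
qed

lemma mirror_walk_hit_prob:
  assumes r: "r > 1" "(1 - p) * (r\<^sup>2 + 1) = 2 * (1 + p) * r"
  shows "\<P>(\<omega> in M. \<exists>n. X n \<omega> = N) = mirror_win r N x"
proof -
  let ?g = "mirror_win r N"
  note bd = mirror_win_boundary[OF r(1) N]
  have const: "(\<Sum>y\<le>N. \<P>(\<omega> in M. X n \<omega> = y) * ?g y) = ?g x" for n
  proof (induction n)
    case 0
    show ?case by (rule mirror_walk_sum_0)
  next
    case (Suc n)
    have "(\<Sum>y\<le>N. \<P>(\<omega> in M. X (Suc n) \<omega> = y) * ?g y) = (\<Sum>y\<le>N. \<P>(\<omega> in M. X n \<omega> = y) * ?g y)"
      unfolding mirror_walk_sum_Suc using mirror_win_harmonic[OF r(2)]
      by (intro sum.cong refl) auto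
    with Suc show ?case by simp
  qed
  have dec: "{..N} = insert N (insert 0 {0<..<N})" using N by auto
  \<comment> \<open>The boundary values 0 and 1 of \<open>?g\<close> isolate the mass at
    \<open>N\<close> in the constant expectation.\<close>
  have "\<P>(\<omega> in M. X n \<omega> = N) = ?g x - (\<Sum>y\<in>{0<..<N}. \<P>(\<omega> in M. X n \<omega> = y) * ?g y)" for n
    using const[of n] N unfolding dec by (simp add: bd)
  moreover have "(\<lambda>n. ?g x - (\<Sum>y\<in>{0<..<N}. \<P>(\<omega> in M. X n \<omega> = y) * ?g y))
      \<longlonglongrightarrow> ?g x - (\<Sum>y\<in>{0<..<N}. 0 * ?g y)"
    by (intro tendsto_intros mirror_walk_interior_tendsto_0) auto
  ultimately show ?thesis
    using LIMSEQ_unique[OF mirror_walk_tendsto_hit] by simp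
qed

end

theorem mainTheorem2:
  fixes N x :: nat and p :: real
    and M :: "'a measure" and X :: "nat \<Rightarrow> 'a \<Rightarrow> nat"
  assumes "N \<ge> 1" and "0 < p" and "p < 1" and "x \<le> N"
    and "markov_chain M (mirror_transition p N) x X"
  shows "\<P>(\<omega> in M. \<exists>n. X n \<omega> = N) =
      1 / 2 * ((((1 - sqrt p) / (1 + sqrt p)) ^ N + 1)
               / (((1 + sqrt p) / (1 - sqrt p)) ^ N - ((1 - sqrt p) / (1 + sqrt p)) ^ N))
            * ((1 + sqrt p) / (1 - sqrt p)) ^ x
    + 1 / 2 * ((((1 + sqrt p) / (1 - sqrt p)) ^ N + 1)
               / (((1 - sqrt p) / (1 + sqrt p)) ^ N - ((1 + sqrt p) / (1 - sqrt p)) ^ N))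
            * ((1 - sqrt p) / (1 + sqrt p)) ^ x
    + 1 / 2"
proof -
  define s where "s = sqrt p"
  have s: "0 < s" "s < 1" "p = s\<^sup>2" using assms by (auto simp: s_def)
  define r where "r = (1 + s) / (1 - s)"
  have r1: "r > 1" using s by (simp add: r_def field_simps)
  have inv: "(1 - s) / (1 + s) = inverse r" by (simp add: r_def)
  have rs: "r * (1 - s) = 1 + s" using s by (simp add: r_def)
  \<comment> \<open>As \<open>1 - p = (1 - s) * (1 + s)\<close>, the extra factor
    \<open>1 - s\<close> supplies the square that clears the denominator of
    \<open>r\<^sup>2\<close>.\<close>
  have "(1 - p) * (r\<^sup>2 + 1) * (1 - s) = 2 * (1 + p) * r * (1 - s)"
    using rs unfolding s(3) by algebra
  then have "(1 - p) * (r\<^sup>2 + 1) = 2 * (1 + p) * r" using s by simp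
  from mirror_walk_hit_prob[OF assms r1 this] mirror_win_closed_form[OF r1 assms(1,4)]
  show ?thesis
    unfolding s_def[symmetric] inv r_def[symmetric] by simp
qed

end
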